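(* Let $r,n$ be positive integers with $2<2r\leq n$, and let $$Q(n,r)=\langle a,b\mid a^{2^n}=b^{2^r}=1,\ a^{2^{n-r}}=[a,b]\rangle .$$ Then every automorphism of $Q(n,r)$ of order $2$ which fixes the Frattini subgroup $\Phi(Q(n,r))$ elementwise is an inner automorphism of $Q(n,r)$.
   Context: $\Phi(G)$ denotes the Frattini subgroup of a group $G$. $[a,b]=a^{-1}b^{-1}ab$ denotes the commutator. *)

theory Defs
  imports "HOL-Algebra.Algebra"
begin

section \<open>Groups given by generators and relations\<close>

text \<open>
  A word over the generators \<open>'g\<close> and their formal inverses: the letter \<open>(x, True)\<close>
  stands for \<open>x\<close>, and \<open>(x, False)\<close> for the inverse of \<open>x\<close>.
\<close>

type_synonym 'g word = "('g \<times> bool) list"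

definition word_inv :: "'g word \<Rightarrow> 'g word"
  where "word_inv w = rev (map (\<lambda>(x, e). (x, \<not> e)) w)"

definition word_pow :: "'g word \<Rightarrow> nat \<Rightarrow> 'g word"
  where "word_pow w k = concat (replicate k w)"

definition word_comm :: "'g word \<Rightarrow> 'g word \<Rightarrow> 'g word"
  where "word_comm u v = word_inv u @ word_inv v @ u @ v"

text \<open>
  A pair \<open>(u, v) \<in> R\<close> is the relation \<open>u = v\<close>. The presented group is the monoid of
  words modulo the least congruence that makes every letter inverse to its formal
  inverse and satisfies the relations in \<open>R\<close>. The generators are all elements of the type
  \<open>'g\<close>.
\<close>

inductive word_cong :: "('g word \<times> 'g word) set \<Rightarrow> 'g word \<Rightarrow> 'g word \<Rightarrow> bool"
  for R :: "('g word \<times> 'g word) set"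
where
  refl: "word_cong R u u"
| sym: "word_cong R u v \<Longrightarrow> word_cong R v u"
| trans: "word_cong R u v \<Longrightarrow> word_cong R v w \<Longrightarrow> word_cong R u w"
| append: "word_cong R u u' \<Longrightarrow> word_cong R v v' \<Longrightarrow> word_cong R (u @ v) (u' @ v')"
| cancel: "word_cong R [(x, e), (x, \<not> e)] []"
| relation: "(u, v) \<in> R \<Longrightarrow> word_cong R u v"

definition word_class :: "('g word \<times> 'g word) set \<Rightarrow> 'g word \<Rightarrow> 'g word set"
  where "word_class R u = {v. word_cong R u v}"

definition presented_group :: "('g word \<times> 'g word) set \<Rightarrow> 'g word set monoid"
  where "presented_group R =
    \<lparr>carrier = range (word_class R),
     monoid.mult = (\<lambda>U V. {w. \<exists>u\<in>U. \<exists>v\<in>V. word_cong R (u @ v) w}),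
     one = word_class R []\<rparr>"

lemma word_class_eq_iff: "word_class R u = word_class R v \<longleftrightarrow> word_cong R u v"
  unfolding word_class_def by (auto intro: word_cong.intros)

lemma carrier_presented_group: "carrier (presented_group R) = range (word_class R)"
  by (simp add: presented_group_def)

lemma one_presented_group: "\<one>\<^bsub>presented_group R\<^esub> = word_class R []"
  by (simp add: presented_group_def)

lemma mult_presented_group:
  "word_class R u \<otimes>\<^bsub>presented_group R\<^esub> word_class R v = word_class R (u @ v)"
  unfolding presented_group_def word_class_def
  by (auto intro: word_cong.intros)

lemma word_inv_cancel: "word_cong R (word_inv w @ w) []"
proof (induction w)
  case Nil
  show ?case by (simp add: word_inv_def word_cong.refl)
next
  case (Cons l w)
  obtain x e where l: "l = (x, e)" by (cases l)
  have "word_cong R ([(x, \<not> e), (x, \<not> \<not> e)] @ w) ([] @ w)"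
    by (intro word_cong.append word_cong.cancel word_cong.refl)
  then have "word_cong R (word_inv w @ ([(x, \<not> e), (x, e)] @ w)) (word_inv w @ w)"
    by (intro word_cong.append) (auto intro: word_cong.refl)
  then show ?case
    using Cons.IH by (auto simp: l word_inv_def intro: word_cong.trans)
qed

lemma group_presented_group: "group (presented_group R)"
proof (rule groupI)
  fix U assume "U \<in> carrier (presented_group R)"
  then obtain u where "U = word_class R u" by (auto simp: carrier_presented_group)
  then have "word_class R (word_inv u) \<otimes>\<^bsub>presented_group R\<^esub> U = \<one>\<^bsub>presented_group R\<^esub>"
    by (simp add: mult_presented_group one_presented_group word_class_eq_iff word_inv_cancel)
  then show "\<exists>V\<in>carrier (presented_group R). V \<otimes>\<^bsub>presented_group R\<^esub> U = \<one>\<^bsub>presented_group R\<^esub>"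
    by (auto simp: carrier_presented_group)
qed (auto simp: carrier_presented_group mult_presented_group one_presented_group)

text \<open>The universal property (von Dyck's theorem).\<close>

definition word_eval :: "('a, 'b) monoid_scheme \<Rightarrow> ('g \<Rightarrow> 'a) \<Rightarrow> 'g word \<Rightarrow> 'a"
  where "word_eval G f w =
    foldr (\<lambda>(x, e) y. (if e then f x else inv\<^bsub>G\<^esub> (f x)) \<otimes>\<^bsub>G\<^esub> y) w \<one>\<^bsub>G\<^esub>"

lemma (in group) word_eval_closed:
  assumes "\<And>x. f x \<in> carrier G"
  shows "word_eval G f w \<in> carrier G"
  by (induction w) (auto simp: word_eval_def assms)

lemma (in group) word_eval_append:
  assumes "\<And>x. f x \<in> carrier G"
  shows "word_eval G f (u @ v) = word_eval G f u \<otimes> word_eval G f v"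
proof (induction u)
  case Nil
  show ?case using word_eval_closed[OF assms, where w = v] by (simp add: word_eval_def)
next
  case (Cons l u)
  show ?case
    using Cons.IH word_eval_closed[OF assms, where w = v] word_eval_closed[OF assms, where w = u]
    by (cases l) (simp add: word_eval_def assms m_assoc)
qed

lemma (in group) word_eval_cong:
  assumes f: "\<And>x. f x \<in> carrier G"
    and R: "\<And>u v. (u, v) \<in> R \<Longrightarrow> word_eval G f u = word_eval G f v"
    and "word_cong R u v"
  shows "word_eval G f u = word_eval G f v"
  using assms(3)
proof induction
  case (cancel x e)
  show ?case by (cases e) (simp_all add: word_eval_def f)
qed (simp_all add: word_eval_append[OF f] R)

theorem (in group) presented_group_universal:
  assumes f: "\<And>x. f x \<in> carrier G"
    and R: "\<And>u v. (u, v) \<in> R \<Longrightarrow> word_eval G f u = word_eval G f v"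
  shows "\<exists>h \<in> hom (presented_group R) G. \<forall>x. h (word_class R [(x, True)]) = f x"
proof -
  define h where "h U = word_eval G f (SOME u. U = word_class R u)" for U
  have h: "h (word_class R u) = word_eval G f u" for u
  proof -
    have "word_class R u = word_class R (SOME v. word_class R u = word_class R v)"
      by (rule someI) simp
    then show ?thesis
      unfolding h_def by (metis word_class_eq_iff word_eval_cong[OF f R])
  qed
  have "h \<in> hom (presented_group R) G"
    by (auto simp: hom_def carrier_presented_group mult_presented_group h
        word_eval_closed[OF f] word_eval_append[OF f])
  moreover have "h (word_class R [(x, True)]) = f x" for x
    by (simp add: h) (simp add: word_eval_def f)
  ultimately show ?thesis by blast
qed


section \<open>The Frattini subgroup and inner automorphisms\<close>

definition maximal_subgroup :: "'a set \<Rightarrow> ('a, 'b) monoid_scheme \<Rightarrow> bool"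
  where "maximal_subgroup M G \<longleftrightarrow>
    subgroup M G \<and> M \<noteq> carrier G \<and>
    (\<forall>H. subgroup H G \<and> M \<subseteq> H \<longrightarrow> H = M \<or> H = carrier G)"

text \<open>If there is no maximal subgroup, the Frattini subgroup is the whole group.\<close>

definition frattini :: "('a, 'b) monoid_scheme \<Rightarrow> 'a set"
  where "frattini G = carrier G \<inter> \<Inter>{M. maximal_subgroup M G}"

text \<open>Like the elements of \<^const>\<open>auto\<close>, inner automorphisms are extensional functions.\<close>

definition inner_auto :: "('a, 'b) monoid_scheme \<Rightarrow> ('a \<Rightarrow> 'a) set"
  where "inner_auto G = (\<lambda>g. \<lambda>x\<in>carrier G. inv\<^bsub>G\<^esub> g \<otimes>\<^bsub>G\<^esub> x \<otimes>\<^bsub>G\<^esub> g) ` carrier G"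


section \<open>The groups \<open>Q(n, r)\<close>\<close>

datatype gen = Gen_a | Gen_b

definition Q_group :: "nat \<Rightarrow> nat \<Rightarrow> gen word set monoid"
  where "Q_group n r =
    (let a = [(Gen_a, True)]; b = [(Gen_b, True)] in
     presented_group
       {(word_pow a (2 ^ n), []),
        (word_pow b (2 ^ r), []),
        (word_pow a (2 ^ (n - r)), word_comm a b)})"

end

(* Put q = 2^(n-r), R = 2^r, N = 2^n = q R. Since N divides q^2, the relations give the normal
   form a^i b^j with (a^i b^j)(a^k b^l) = a^(i + k - q j k) b^(j + l); a concrete model on
   Z/N x Z/R shows that i mod N and j mod R are determined.

   Every maximal subgroup contains the central element a^q = [a,b], because a^q is an even power
   of an element of 2-power order. So it contains all commutators, is normal, and for the same
   reason contains a^2 and b^2.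

   Let phi(a) = a^i b^j and phi(b) = a^k b^l. From phi(a^2) = a^2, phi(b^2) = b^2 and
   phi([a,b]) = [a,b] alone, j = R/2 would still be possible; phi(phi(a)) = a excludes it. What
   remains is phi(a) = a^(1 + s N/2) and phi(b) = a^(u N/2) b, which is conjugation by
   a^(-u R/2) b^(s R/2). *)
theory Submission
  imports Defs
begin

section \<open>Conjugation of powers, and even powers in maximal subgroups of an arbitrary
  group\<close>

lemma (in group) int_pow_conj:
  assumes "x \<in> carrier G" "y \<in> carrier G" "z \<in> carrier G" "x \<otimes> z = z \<otimes> y"
  shows "x [^] (i::int) \<otimes> z = z \<otimes> y [^] i"
proof -
  have nat: "x [^] k \<otimes> z = z \<otimes> y [^] k" for k :: nat
  proof (induction k)
    case (Suc k)
    have "x [^] Suc k \<otimes> z = x [^] k \<otimes> (z \<otimes> y)"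
      using assms by (simp add: m_assoc)
    also have "\<dots> = x [^] k \<otimes> z \<otimes> y"
      using assms(1-3) by (simp add: m_assoc)
    also have "\<dots> = z \<otimes> y [^] Suc k"
      unfolding Suc using assms(1-3) by (simp add: m_assoc)
    finally show ?case .
  qed (simp add: assms(1-3))
  have neg: "inv u \<otimes> z = z \<otimes> inv v"
    if "u \<in> carrier G" "v \<in> carrier G" "u \<otimes> z = z \<otimes> v" for u v
  proof -
    have "u \<otimes> (z \<otimes> inv v) = u \<otimes> z \<otimes> inv v"
      using that(1,2) assms(3) by (simp add: m_assoc)
    also have "\<dots> = z"
      unfolding that(3) using that(1,2) assms(3) by (simp add: m_assoc)
    finally show ?thesis
      using that(1,2) assms(3) by (metis inv_closed inv_solve_left m_closed)
  qed
  show ?thesis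
  proof (cases i rule: int_cases2)
    case (nonneg k)
    then show ?thesis using nat by (simp add: int_pow_int)
  next
    case (nonpos k)
    have "inv (x [^] k) \<otimes> z = z \<otimes> inv (y [^] k)"
      by (rule neg[OF _ _ nat]) (simp_all add: assms(1,2))
    then show ?thesis using nonpos assms(1,2) by (simp add: int_pow_neg_int)
  qed
qed

text \<open>If \<open>y\<close> were outside \<open>M\<close>, maximality would make
  \<open>M <#> generate G {y}\<close> the whole group, so \<open>x\<close> is some \<open>h\<close>
  in \<open>M\<close> times a power of \<open>y\<close>. Then \<open>h\<close> is an odd power of
  \<open>x\<close>; odd exponents are invertible modulo \<open>2 ^ m\<close>, so \<open>x\<close>,
  and with it \<open>y\<close>, lies in \<open>M\<close>. Assumption \<open>K\<close> is left open
  because it is met in two ways: \<open>y\<close> central, or \<open>M\<close> normal.\<close>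

lemma (in group) maximal_subgroup_contains:
  assumes M: "maximal_subgroup M G" and K: "subgroup (M <#> generate G {y}) G"
    and x: "x \<in> carrier G" "x [^] (2 ^ m :: nat) = \<one>" and y: "y = x [^] (2 * k :: int)"
  shows "y \<in> M"
proof (rule ccontr)
  assume ny: "y \<notin> M"
  have yc: "y \<in> carrier G" using x y by simp
  have sM: "subgroup M G" using M by (simp add: maximal_subgroup_def)
  have one: "\<one> \<in> generate G {y}" "y \<in> generate G {y}"
    by (auto intro: generate.one generate.incl)
  have MC: "M \<subseteq> carrier G" using sM by (rule subgroup.subset)
  have "M \<subseteq> M <#> generate G {y}"
    using one MC by (force simp: set_mult_def)
  moreover have "y \<in> M <#> generate G {y}"
    using one yc subgroup.one_closed[OF sM] by (force simp: set_mult_def)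
  ultimately have "M <#> generate G {y} = carrier G"
    using M K ny by (auto simp: maximal_subgroup_def)
  then obtain h i where h: "h \<in> M" and "x = h \<otimes> y [^] (i::int)"
    using x(1) unfolding set_mult_def generate_pow[OF yc] by blast
  then have "h = x \<otimes> inv (y [^] i)"
    using yc x(1) MC by (metis int_pow_closed inv_solve_right subsetD)
  also have "\<dots> = x [^] (1 - 2 * k * i)"
    using x(1) by (simp add: y int_pow_pow int_pow_diff)
  finally have odd_pow: "x [^] (1 - 2 * k * i) \<in> M" using h by simp
  have "coprime (1 - 2 * k * i) (2 ^ m)" by simp
  then obtain u v where "(1 - 2 * k * i) * u + 2 ^ m * v = 1"
    by (metis bezout_int coprime_imp_gcd_eq_1 mult.commute)
  then have "x = x [^] ((1 - 2 * k * i) * u + 2 ^ m * v)"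
    using x(1) by simp
  also have "\<dots> = (x [^] (1 - 2 * k * i)) [^] u \<otimes> (x [^] (2 ^ m :: int)) [^] v"
    using x(1) by (simp add: int_pow_mult int_pow_pow)
  also have "x [^] (2 ^ m :: int) = \<one>"
    using x int_pow_int[of G x "2 ^ m"] by simp
  finally have "x = (x [^] (1 - 2 * k * i)) [^] u"
    using x(1) by simp
  then have "x \<in> M"
    using subgroup_int_pow_closed[OF sM odd_pow] by metis
  then show False
    using ny y subgroup_int_pow_closed[OF sM] by simp
qed

lemma (in group) maximal_subgroup_contains_central:
  assumes M: "maximal_subgroup M G" and x: "x \<in> carrier G" "x [^] (2 ^ m :: nat) = \<one>"
    and y: "y = x [^] (2 * k :: int)"
    and central: "\<And>g. g \<in> carrier G \<Longrightarrow> y \<otimes> g = g \<otimes> y"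
  shows "y \<in> M"
proof -
  have yc: "y \<in> carrier G" using x y by simp
  have sM: "subgroup M G" using M by (simp add: maximal_subgroup_def)
  have "generate G {y} \<lhd> G"
  proof (rule normal_invI)
    show "subgroup (generate G {y}) G" using yc by (simp add: generate_is_subgroup)
    fix g h assume "h \<in> carrier G" "g \<in> generate G {y}"
    then show "h \<otimes> g \<otimes> inv h \<in> generate G {y}"
      using int_pow_conj[OF yc yc _ central] yc
      by (auto simp: generate_pow[OF yc]) (metis int_pow_closed inv_solve_right m_closed)
  qed
  then have "subgroup (M <#> generate G {y}) G"
    using sM by (metis commut_normal mult_norm_subgroup)
  then show ?thesis using maximal_subgroup_contains M x y by blast
qed

lemma (in group) normal_maximal_subgroup_contains:
  assumes M: "maximal_subgroup M G" and "M \<lhd> G"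
    and x: "x \<in> carrier G" "x [^] (2 ^ m :: nat) = \<one>"
  shows "x \<otimes> x \<in> M"
proof -
  have "x [^] (2 * 1 :: int) = x \<otimes> x"
    using int_pow_mult[of x 1 1] x by simp
  moreover have "subgroup (M <#> generate G {x \<otimes> x}) G"
    using mult_norm_subgroup[OF assms(2)] generate_is_subgroup[of "{x \<otimes> x}"] x by simp
  ultimately show ?thesis
    using maximal_subgroup_contains[OF M] x by metis
qed

section \<open>Normal form in a group satisfying the relations, and congruences between
  exponents\<close>

locale Q_relations = group G for G (structure) +
  fixes a b n r
  assumes r: "2 \<le> r" and rn: "2 * r \<le> n"
    and a: "a \<in> carrier G" and b: "b \<in> carrier G"
    and a_pow: "a [^] (2 ^ n :: nat) = \<one>" and b_pow: "b [^] (2 ^ r :: nat) = \<one>"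
    and comm: "a \<otimes> b = b \<otimes> (a \<otimes> a [^] (2 ^ (n - r) :: nat))"
begin

definition q :: int where "q = 2 ^ (n - r)"
definition R :: int where "R = 2 ^ r"
definition N :: int where "N = 2 ^ n"
text \<open>The exponent of \<open>a\<close> is an integer because the product formula subtracts;
  for \<open>b\<close> naturals suffice, its inverse being a natural power, and they allow
  induction.\<close>

definition e :: "int \<Rightarrow> nat \<Rightarrow> 'a" where "e i j = a [^] i \<otimes> b [^] j"

lemma N_eq: "N = q * R"
  using rn by (simp add: N_def q_def R_def flip: power_add)

lemma four_dvd_R: "4 dvd R"
  using r le_imp_power_dvd[of 2 r "2::int"] by (simp add: R_def)

lemma R_dvd_q: "R dvd q"
  using rn by (simp add: q_def R_def le_imp_power_dvd)

text \<open>The bound \<open>2 * r \<le> n\<close> enters here through \<open>R_dvd_q\<close>. It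
  makes the action of \<open>b\<close> on exponents linear: modulo \<open>N\<close>, the
  \<open>j\<close>-th power of \<open>1 - q\<close> is \<open>1 - q * j\<close>.\<close>

lemma N_dvd_qq: "N dvd q * q"
  using R_dvd_q by (simp add: N_eq)

lemma a_int_pow_N: "N dvd i \<Longrightarrow> a [^] i = \<one>"
  using a a_pow int_pow_int[of G a "2 ^ n"] by (auto simp: N_def simp flip: int_pow_pow)

lemma a_int_pow_eq: "N dvd i - k \<Longrightarrow> a [^] i = a [^] k"
  using a_int_pow_N[of "i - k"] a int_pow_mult[of a "i - k" k] by simp

lemma b_a_int_pow: "b \<otimes> a [^] (i::int) = a [^] (i * (1 - q)) \<otimes> b"
proof -
  have "a \<otimes> a [^] (2 ^ (n - r) :: nat) = a [^] (1 + q)"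
    using a int_pow_int[of G a "2 ^ (n - r)"] by (simp add: int_pow_mult q_def)
  then have "a [^] (i * (1 - q)) \<otimes> b = b \<otimes> a [^] ((1 + q) * (i * (1 - q)))"
    using int_pow_conj[of a "a [^] (1 + q)" b "i * (1 - q)"] a b comm by (simp add: int_pow_pow)
  \<comment> \<open>Modulo \<open>N\<close>, \<open>1 - q\<close> is the inverse of
    \<open>1 + q\<close>, since their product is \<open>1 - q * q\<close>.\<close>
  also have "a [^] ((1 + q) * (i * (1 - q))) = a [^] i"
    by (rule a_int_pow_eq) (use N_dvd_qq in \<open>simp add: algebra_simps\<close>)
  finally show ?thesis by simp
qed

lemma b_pow_a_int_pow: "b [^] (j::nat) \<otimes> a [^] (i::int) = a [^] (i * (1 - q * j)) \<otimes> b [^] j"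
proof (induction j arbitrary: i)
  case (Suc j)
  have "b [^] Suc j \<otimes> a [^] i = b [^] j \<otimes> a [^] (i * (1 - q)) \<otimes> b"
    using a b by (simp add: m_assoc b_a_int_pow)
  also have "\<dots> = a [^] (i * (1 - q) * (1 - q * j)) \<otimes> b [^] Suc j"
    using a b by (simp add: m_assoc Suc)
  also have "a [^] (i * (1 - q) * (1 - q * j)) = a [^] (i * (1 - q * Suc j))"
    by (rule a_int_pow_eq) (use N_dvd_qq in \<open>simp add: algebra_simps\<close>)
  finally show ?case .
qed (use a in simp)

lemma e_closed [simp]: "e i j \<in> carrier G"
  using a b by (simp add: e_def)

lemma e_mult: "e i j \<otimes> e k l = e (i + k - q * j * k) (j + l)"
proof -
  have "e i j \<otimes> e k l = a [^] i \<otimes> (b [^] j \<otimes> a [^] k) \<otimes> b [^] l"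
    using a b by (simp add: e_def m_assoc)
  also have "\<dots> = a [^] i \<otimes> a [^] (k * (1 - q * j)) \<otimes> (b [^] j \<otimes> b [^] l)"
    using a b by (simp add: b_pow_a_int_pow m_assoc)
  also have "\<dots> = e (i + k - q * j * k) (j + l)"
    using a b by (simp add: e_def nat_pow_mult algebra_simps flip: int_pow_mult)
  finally show ?thesis .
qed

lemma e_gens: "e 0 0 = \<one>" "e 1 0 = a" "e 0 1 = b" "e i 0 = a [^] i" "e 0 j = b [^] j"
  using a b by (simp_all add: e_def)

lemma e_mod: "e i j = e (i mod N) (nat (j mod R))"
proof -
  have "b [^] j = b [^] (2 ^ r * (j div 2 ^ r) + j mod 2 ^ r)"
    by simp
  also have "\<dots> = (b [^] (2 ^ r :: nat)) [^] (j div 2 ^ r) \<otimes> b [^] (j mod 2 ^ r)"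
    unfolding nat_pow_pow[OF b] nat_pow_mult[OF b] ..
  finally have "b [^] j = b [^] (j mod 2 ^ r)"
    using b b_pow by simp
  moreover have "nat (j mod R) = j mod 2 ^ r"
    by (simp add: R_def nat_mod_distrib nat_power_eq)
  moreover have "a [^] i = a [^] (i mod N)"
    by (rule a_int_pow_eq) simp
  ultimately show ?thesis by (simp add: e_def)
qed


lemma e_eqI:
  assumes "N dvd i - k" "R dvd int j - int l"
  shows "e i j = e k l"
  using assms e_mod[of i j] e_mod[of k l] by (metis mod_eq_dvd_iff)

lemma generate_eq_e:
  assumes "x \<in> generate G {a, b}"
  shows "\<exists>i j. x = e i j"
  using assms
proof induction
  case one
  show ?case by (metis e_gens(1))
next
  case (incl h)
  then show ?case using e_gens(2,3) by (metis insert_iff singletonD)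
next
  case (inv h)
  have "inv a = e (- 1) 0" using a by (simp add: e_gens int_pow_neg)
  moreover have "b [^] (2 ^ r - 1 :: nat) \<otimes> b = \<one>"
    using b b_pow by (metis Suc_diff_1 nat_pow_Suc pos2 zero_less_power)
  then have "inv b = e 0 (2 ^ r - 1)"
    using b by (simp add: e_gens inv_equality)
  ultimately show ?case using inv by blast
next
  case (eng h1 h2)
  then show ?case by (metis e_mult)
qed

end

text \<open>Here \<open>i\<close>, \<open>j\<close> are the exponents of the image of
  \<open>a\<close>, and \<open>k\<close>, \<open>l\<close> those of the image of \<open>b\<close>.
  The assumptions \<open>a2\<close>, \<open>b2\<close>, \<open>comm\<close> say that the squares of
  \<open>a\<close> and \<open>b\<close> and the commutator are fixed; \<open>inv\<close> says that
  the map is an involution at \<open>a\<close>.\<close>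

lemma Q_arith:
  fixes q R i j k l :: int
  assumes q0: "q \<noteq> 0" and R4: "4 dvd R" and Rq: "R dvd q" and R2: "\<exists>m. R = 2 ^ m" and q2: "\<exists>m. q = 2 ^ m"
    and a2: "q * R dvd 2 * i - q * j * i - 2"
    and b2: "q * R dvd 2 * k - q * l * k"
    and comm: "R dvd l * i - j * k - 1"
    and inv: "q * R dvd 2 * i - 2 - q * j * (i - 1)"
  obtains s u where "2 * i = 2 + q * R * s" "2 * k = q * R * u" "R dvd j" "R dvd l - 1"
proof -
  \<comment> \<open>Subtracting \<open>a2\<close> from \<open>inv\<close> leaves exactly
    \<open>q * j\<close>; this rules out \<open>j\<close> being an odd multiple of
    \<open>R / 2\<close>.\<close>
  have "q * R dvd q * j"
    using dvd_diff[OF inv a2] by (simp add: algebra_simps)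
  then have j: "R dvd j" using q0 by simp
  then have "q * R dvd q * j * i" by (simp add: mult.assoc)
  then have "q * R dvd 2 * i - 2"
    using dvd_add[OF a2 \<open>q * R dvd q * j * i\<close>] by (simp add: algebra_simps)
  then obtain s where s: "2 * i - 2 = q * R * s" ..
  obtain S where S: "R = 2 * S" using R4 by (metis dvd_def mult.assoc numeral_Bit0_eq_double)
  have "2 dvd S" using R4 S by auto
  have i: "i = 1 + q * S * s" using s S by simp
  then have "R dvd i - 1" using Rq by simp
  have "l - 1 = (l * i - j * k - 1) - l * (i - 1) + j * k" by (simp add: algebra_simps)
  then have l: "R dvd l - 1"
    using comm \<open>R dvd i - 1\<close> j by (metis dvd_add dvd_diff dvd_mult dvd_mult2)
  obtain T where "q = R * T" using Rq ..
  then have T: "q = 2 * (S * T)" using S by simp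
  \<comment> \<open>Since 4 divides \<open>R\<close>, \<open>S\<close> is even, so the first factor
    is odd and can be cancelled modulo a power of 2.\<close>
  have "2 * k - q * l * k = (1 - S * T * l) * (2 * k)" using T by (simp add: algebra_simps)
  moreover have "coprime (q * R) (1 - S * T * l)"
    using R2 q2 \<open>2 dvd S\<close> by (auto simp flip: power_add)
  ultimately have "q * R dvd 2 * k"
    using b2 by (metis coprime_dvd_mult_right_iff)
  then obtain u where "2 * k = q * R * u" ..
  then show ?thesis using that[of s u] s j l by simp
qed

section \<open>Frattini subgroup and involutions when the normal form is unique\<close>

locale Q_faithful = Q_relations +
  assumes generated: "carrier G \<subseteq> generate G {a, b}"
    and faithful: "e i j = e k l \<Longrightarrow> N dvd i - k \<and> R dvd int j - int l"
begin

lemma e_surj: "x \<in> carrier G \<Longrightarrow> \<exists>i j. x = e i j"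
  using generated generate_eq_e by blast

lemma maximal_subgroup_squares:
  assumes H: "maximal_subgroup H G"
  shows "a \<otimes> a \<in> H" "b \<otimes> b \<in> H"
proof -
  have sH: "subgroup H G" using H by (simp add: maximal_subgroup_def)
  obtain k where k: "q = 2 * k"
    using R_dvd_q four_dvd_R by (metis dvd_def mult.assoc numeral_Bit0_eq_double)
  \<comment> \<open>\<open>e q 0\<close> is the commutator of \<open>a\<close> and \<open>b\<close>.
    It is central because moving it past \<open>b\<close> changes the exponent of \<open>a\<close>
    only by multiples of \<open>q * q\<close>.\<close>
  have c: "e q 0 \<in> H"
  proof (rule maximal_subgroup_contains_central[OF H a a_pow])
    show "e q 0 = a [^] (2 * k)" by (simp add: e_gens k)
  next
    fix g assume "g \<in> carrier G"
    then obtain i j where "g = e i j" using e_surj by blast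
    then show "e q 0 \<otimes> g = g \<otimes> e q 0"
      using N_dvd_qq by (auto simp: e_mult algebra_simps intro!: e_eqI)
  qed
  have "H \<lhd> G"
  proof (rule normal_invI[OF sH])
    fix g h assume gh: "g \<in> carrier G" "h \<in> H"
    then have hc: "h \<in> carrier G" using subgroup.mem_carrier[OF sH] by blast
    obtain i j k l where g: "g = e i j" and h: "h = e k l"
      using e_surj gh(1) hc by meson
    \<comment> \<open>This exponent is the difference between the product formulas for
      \<open>g \<otimes> h\<close> and \<open>h \<otimes> g\<close>. Every commutator is thus a
      power of \<open>e q 0\<close>, which makes \<open>H\<close> normal.\<close>
    have "e (q * (l * i - j * k)) 0 \<in> H"
      using subgroup_int_pow_closed[OF sH c, of "l * i - j * k"] a
      by (simp add: e_gens int_pow_pow)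
    moreover have "g \<otimes> h = e (q * (l * i - j * k)) 0 \<otimes> h \<otimes> g"
      by (simp add: g h e_mult algebra_simps)
    then have "g \<otimes> h \<otimes> inv g = e (q * (l * i - j * k)) 0 \<otimes> h"
      using gh(1) hc by (simp add: inv_solve_right')
    ultimately show "g \<otimes> h \<otimes> inv g \<in> H"
      using gh(2) subgroup.m_closed[OF sH] by simp
  qed
  then show "a \<otimes> a \<in> H" "b \<otimes> b \<in> H"
    using normal_maximal_subgroup_contains[OF H] a b a_pow b_pow by blast+
qed

lemma hom_e:
  assumes "f \<in> hom G G"
  shows "f (e i j) = f a [^] i \<otimes> f b [^] j"
proof -
  interpret f: group_hom G G f using assms by unfold_locales
  show ?thesis using a b by (simp add: e_def f.hom_int_pow f.hom_nat_pow)
qed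

lemma involution_inner:
  assumes hom: "\<phi> \<in> hom G G" and ext: "\<phi> \<in> extensional (carrier G)"
    and invol: "\<phi> (\<phi> a) = a"
    and fix_frattini: "\<And>x. x \<in> frattini G \<Longrightarrow> \<phi> x = x"
  shows "\<phi> \<in> inner_auto G"
proof -
  interpret f: group_hom G G \<phi> using hom by unfold_locales
  have sq: "\<phi> (a \<otimes> a) = a \<otimes> a" "\<phi> (b \<otimes> b) = b \<otimes> b"
    using a b by (intro fix_frattini; simp add: frattini_def maximal_subgroup_squares)+
  \<comment> \<open>Such elements are products of powers of the two fixed squares. This is used for
    the commutator \<open>e q 0\<close> and for \<open>e (i - 1) j\<close>.\<close>
  have even: "\<phi> (e i j) = e i j" if "even i" "even j" for i j
  proof -
    obtain x y where "i = 2 * x" "j = 2 * y" using \<open>even i\<close> \<open>even j\<close> by (auto elim!: evenE)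
    then have "a [^] i = (a \<otimes> a) [^] x" "b [^] j = (b \<otimes> b) [^] y"
      using a b int_pow_pow[of a 2 x] int_pow_mult[of a 1 1] nat_pow_pow[of b 2 y]
      by (simp_all add: mult.commute numeral_2_eq_2)
    then show ?thesis
      using a b sq by (simp add: e_def f.hom_int_pow f.hom_nat_pow)
  qed
  obtain i j where A: "\<phi> a = e i j" using e_surj[OF f.hom_closed[OF a]] by blast
  obtain k l where B: "\<phi> b = e k l" using e_surj[OF f.hom_closed[OF b]] by blast
  have four_q: "4 dvd q" using four_dvd_R R_dvd_q by (rule dvd_trans)
  have "e i j \<otimes> e i j = e 1 0 \<otimes> e 1 0"
    using sq(1) a by (simp add: A e_gens(2))
  then have "e (2 * i - q * j * i) (2 * j) = e 2 0"
    unfolding e_mult mult_2[symmetric] by simp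
  from faithful[OF this] have a2: "N dvd 2 * i - q * j * i - 2" and j2: "R dvd 2 * int j"
    by simp_all
  have "e k l \<otimes> e k l = e 0 1 \<otimes> e 0 1"
    using sq(2) b unfolding e_gens(3) by (simp add: B)
  then have "e (2 * k - q * l * k) (2 * l) = e 0 2"
    unfolding e_mult mult_2[symmetric] by simp
  from faithful[OF this] have b2: "N dvd 2 * k - q * l * k"
    by simp
  have "4 dvd N" using four_q by (simp add: N_eq)
  then have "4 dvd (2 * i - q * j * i - 2) + q * (j * i)"
    using a2 four_q by (intro dvd_add) (auto intro: dvd_trans)
  also have "(2 * i - q * j * i - 2) + q * (j * i) = 2 * (i - 1)" by simp
  finally have "even (i - 1)" by presburger
  have "4 dvd 2 * int j" using four_dvd_R j2 by (rule dvd_trans)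
  then have "even j" by presburger
  \<comment> \<open>Both exponents of the second factor are even, so \<open>\<phi>\<close> fixes it.
    Applying \<open>\<phi>\<close> to this factorization of \<open>\<phi> a\<close> evaluates
    \<open>\<phi> (\<phi> a)\<close> without knowing \<open>\<phi>\<close> on general
    elements.\<close>
  have "e i j = a \<otimes> e (i - 1) j"
    using e_mult[of 1 0 "i - 1" j] by (simp add: e_gens(2))
  then have "a = e i j \<otimes> e (i - 1) j"
    using invol even[OF \<open>even (i - 1)\<close> \<open>even j\<close>] a by (simp add: A)
  moreover have "i + (i - 1) - q * j * (i - 1) = 2 * i - 1 - q * j * (i - 1)" by simp
  ultimately have "e (2 * i - 1 - q * j * (i - 1)) (2 * j) = e 1 0"
    by (simp only: e_mult e_gens(2) mult_2[symmetric])
  from faithful[OF this] have inv: "N dvd 2 * i - 2 - q * j * (i - 1)"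
    by (simp add: algebra_simps)
  \<comment> \<open>The commutator relation without inverses. Its image under \<open>\<phi>\<close>
    is a congruence modulo \<open>N = q * R\<close> whose common factor \<open>q\<close> cancels,
    leaving one modulo \<open>R\<close>.\<close>
  have "e 1 0 \<otimes> e 0 1 = e q 0 \<otimes> (e 0 1 \<otimes> e 1 0)"
    unfolding e_mult by simp
  then have "a \<otimes> b = e q 0 \<otimes> (b \<otimes> a)"
    unfolding e_gens(2,3) .
  then have "\<phi> (a \<otimes> b) = \<phi> (e q 0 \<otimes> (b \<otimes> a))" by simp
  moreover have "\<phi> (e q 0) = e q 0"
    using even[of q 0] four_q by auto
  ultimately have "\<phi> a \<otimes> \<phi> b = e q 0 \<otimes> (\<phi> b \<otimes> \<phi> a)"
    using a b by simp
  then have "e (i + k - q * j * k) (j + l) = e (q + (k + i - q * l * i)) (l + j)"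
    by (simp add: A B e_mult)
  from faithful[OF this] have "q * R dvd q * (l * i - j * k - 1)"
    by (simp add: algebra_simps N_eq)
  then have comm: "R dvd l * i - j * k - 1" by (simp add: q_def)
  obtain s u where s: "2 * i = 2 + q * R * s" and u: "2 * k = q * R * u"
    and j: "R dvd j" and l: "R dvd int l - 1"
    using Q_arith[of q R i j k l] four_dvd_R R_dvd_q a2 b2 comm inv
    by (auto simp: N_eq q_def R_def)
  obtain S where S: "R = 2 * S" "S > 0"
  proof -
    obtain m where "R = 4 * m" using four_dvd_R ..
    moreover have "R > 0" by (simp add: R_def)
    ultimately show ?thesis using that[of "2 * m"] by simp
  qed
  have i': "i = 1 + q * S * s" and k': "k = q * S * u" using s u S by simp_all
  \<comment> \<open>Conjugation by the power of \<open>a\<close> multiplies \<open>b\<close> by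
    \<open>a [^] (q * S * u)\<close>; conjugation by the power of \<open>b\<close> changes the
    exponent of \<open>a\<close> by \<open>q * S * s\<close> modulo \<open>N\<close>. Taking
    \<open>s mod 2\<close> makes the exponent of \<open>b\<close> nonnegative and is harmless
    because \<open>2 * (q * S) = N\<close>.\<close>
  define g where "g = e (- (S * u)) (nat (S * (s mod 2)))"
  have gc: "g \<in> carrier G" by (simp add: g_def)
  have "e 1 0 \<otimes> g = g \<otimes> e i j"
  proof -
    \<comment> \<open>The two exponents of \<open>a\<close> differ by \<open>q * S\<close> times
      this number, up to sign; evenness supplies the factor 2 that completes
      \<open>N\<close>.\<close>
    have "even (s - (s mod 2) * i)" using \<open>even (i - 1)\<close> by auto
    then have "q * R dvd q * S * (s - (s mod 2) * i)" by (auto simp: S)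
    then show ?thesis
      using j S unfolding g_def e_mult
      by (intro e_eqI) (auto simp: i' N_eq algebra_simps)
  qed
  moreover have "e 0 1 \<otimes> g = g \<otimes> e k l"
  proof -
    have "q * R dvd q * (q * (S * (s mod 2) * S * u))"
      using R_dvd_q by simp
    then show ?thesis
      using l S unfolding g_def e_mult
      by (intro e_eqI) (auto simp: k' N_eq algebra_simps)
  qed
  ultimately have conj: "\<phi> a = inv g \<otimes> a \<otimes> g" "\<phi> b = inv g \<otimes> b \<otimes> g"
    unfolding e_gens(2,3) using a b gc by (simp_all add: A B m_assoc inv_solve_left)
  have cancel: "g \<otimes> (inv g \<otimes> z) = z" if "z \<in> carrier G" for z
    using that gc by (simp flip: m_assoc)
  have conj_hom: "(\<lambda>x. inv g \<otimes> x \<otimes> g) \<in> hom G G"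
    using gc by (auto simp: hom_def m_assoc cancel)
  \<comment> \<open>Two homomorphisms with the same values at \<open>a\<close> and \<open>b\<close>
    agree on every normal form.\<close>
  have "\<phi> (e i j) = inv g \<otimes> e i j \<otimes> g" for i j
    using hom_e[OF hom, of i j] hom_e[OF conj_hom, of i j] by (simp only: conj)
  then have "\<phi> x = inv g \<otimes> x \<otimes> g" if "x \<in> carrier G" for x
    using e_surj[OF that] by blast
  then have "\<phi> = (\<lambda>x\<in>carrier G. inv g \<otimes> x \<otimes> g)"
    using ext by (auto simp: fun_eq_iff extensional_def)
  then show ?thesis using gc by (auto simp: inner_auto_def)
qed

end

section \<open>A concrete model of the relations on pairs of residues\<close>

lemma power_diff_square_dvd:
  assumes "2 * r \<le> n"
  shows "(2::int) ^ n dvd 2 ^ (n - r) * 2 ^ (n - r)"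
  using assms by (simp add: le_imp_power_dvd flip: power_add)

text \<open>For \<open>2 * r \<le> n\<close> this is the semidirect product of the cyclic groups of
  orders \<open>2 ^ n\<close> and \<open>2 ^ r\<close>, where \<open>j\<close> acts as
  multiplication by \<open>1 - 2 ^ (n - r) * j\<close>. The formula is the one in
  \<open>e_mult\<close>.\<close>

definition Q_model :: "nat \<Rightarrow> nat \<Rightarrow> (int \<times> int) monoid"
  where "Q_model n r =
    \<lparr>carrier = {0..<2 ^ n} \<times> {0..<2 ^ r},
     monoid.mult = (\<lambda>(i, j) (k, l). ((i + k - 2 ^ (n - r) * j * k) mod 2 ^ n, (j + l) mod 2 ^ r)),
     one = (0, 0)\<rparr>"

lemma Q_model_mult:
  "(i, j) \<otimes>\<^bsub>Q_model n r\<^esub> (k, l) = ((i + k - 2 ^ (n - r) * j * k) mod 2 ^ n, (j + l) mod 2 ^ r)"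
  by (simp add: Q_model_def)

text \<open>Well-definedness of the action: the factor \<open>2 ^ (n - r)\<close> turns a multiple
  of \<open>2 ^ r\<close> into one of \<open>2 ^ n\<close>. It removes the inner \<open>mod\<close>
  of a second coordinate.\<close>

lemma mod_mult_power_diff:
  fixes x y :: int
  assumes "r \<le> n" "x mod 2 ^ r = y mod 2 ^ r"
  shows "(u - 2 ^ (n - r) * x * k) mod 2 ^ n = (u - 2 ^ (n - r) * y * k) mod 2 ^ n"
proof -
  have "(2::int) ^ n = 2 ^ (n - r) * 2 ^ r" using assms(1) by (simp flip: power_add)
  moreover have "2 ^ r dvd x - y" using assms(2) by (simp add: mod_eq_dvd_iff)
  ultimately have "2 ^ n dvd 2 ^ (n - r) * (x - y) * k" by simp
  then have "2 ^ n dvd - (2 ^ (n - r) * (x - y) * k)"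
    by (rule dvd_minus_iff[THEN iffD2])
  then show ?thesis by (simp add: mod_eq_dvd_iff algebra_simps)
qed

lemma group_Q_model:
  assumes "2 * r \<le> n"
  shows "group (Q_model n r)"
proof (rule groupI)
  have rn: "r \<le> n" using assms by auto
  fix x y z
  assume "x \<in> carrier (Q_model n r)" "y \<in> carrier (Q_model n r)" "z \<in> carrier (Q_model n r)"
  obtain i j k l m p where xyz: "x = (i, j)" "y = (k, l)" "z = (m, p)" by (metis surj_pair)
  let ?q = "2 ^ (n - r) :: int"
  have "((i + k - ?q * j * k) mod 2 ^ n + m - ?q * ((j + l) mod 2 ^ r) * m) mod 2 ^ n
    = ((i + k - ?q * j * k) mod 2 ^ n + m - ?q * (j + l) * m) mod 2 ^ n"
    by (rule mod_mult_power_diff[OF rn]) simp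
  also have "\<dots> = (i + k - ?q * j * k + m - ?q * (j + l) * m) mod 2 ^ n"
    by (metis mod_add_left_eq mod_diff_left_eq)
  \<comment> \<open>Associativity holds up to the term \<open>?q * ?q * j * l * m\<close>, which
    vanishes modulo \<open>2 ^ n\<close>.\<close>
  also have "\<dots> = (i + (k + m - ?q * l * m) - ?q * j * (k + m - ?q * l * m)) mod 2 ^ n"
    unfolding mod_eq_dvd_iff using dvd_mult2[OF power_diff_square_dvd[OF assms], of "- (j * l * m)"]
    by (simp add: algebra_simps)
  also have "\<dots> = (i + (k + m - ?q * l * m) mod 2 ^ n - ?q * j * ((k + m - ?q * l * m) mod 2 ^ n)) mod 2 ^ n"
    by (rule mod_diff_cong) (simp_all only: mod_simps)
  finally show "x \<otimes>\<^bsub>Q_model n r\<^esub> y \<otimes>\<^bsub>Q_model n r\<^esub> z = x \<otimes>\<^bsub>Q_model n r\<^esub> (y \<otimes>\<^bsub>Q_model n r\<^esub> z)"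
    by (simp add: xyz Q_model_mult mod_simps add.assoc)
next
  fix x assume "x \<in> carrier (Q_model n r)"
  then obtain i j where x: "x = (i, j)" "0 \<le> i" "i < 2 ^ n" "0 \<le> j" "j < 2 ^ r" by (auto simp: Q_model_def)
  have rn: "r \<le> n" using assms by auto
  \<comment> \<open>The second coordinate must be \<open>- j\<close>; the first then solves a linear
    equation in which the twist has become \<open>+ 2 ^ (n - r) * j * i\<close>.\<close>
  let ?y = "((- i - 2 ^ (n - r) * j * i) mod 2 ^ n, (- j) mod 2 ^ r)"
  have "((- i - 2 ^ (n - r) * j * i) mod 2 ^ n + i - 2 ^ (n - r) * ((- j) mod 2 ^ r) * i) mod 2 ^ n
     = ((- i - 2 ^ (n - r) * j * i) mod 2 ^ n + i - 2 ^ (n - r) * (- j) * i) mod 2 ^ n"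
    by (rule mod_mult_power_diff[OF rn]) simp
  also have "\<dots> = (- i - 2 ^ (n - r) * j * i + i - 2 ^ (n - r) * (- j) * i) mod 2 ^ n"
    by (metis mod_add_left_eq mod_diff_left_eq)
  finally have "?y \<otimes>\<^bsub>Q_model n r\<^esub> x = \<one>\<^bsub>Q_model n r\<^esub>"
    by (simp add: x(1) Q_model_mult mod_simps) (simp add: Q_model_def)
  moreover have "?y \<in> carrier (Q_model n r)" by (simp add: Q_model_def)
  ultimately show "\<exists>y\<in>carrier (Q_model n r). y \<otimes>\<^bsub>Q_model n r\<^esub> x = \<one>\<^bsub>Q_model n r\<^esub>" by blast
qed (auto simp: Q_model_def)

lemma Q_model_pow:
  shows "(1, 0) [^]\<^bsub>Q_model n r\<^esub> (k::nat) = (int k mod 2 ^ n, 0)"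
    and "(0, 1) [^]\<^bsub>Q_model n r\<^esub> (k::nat) = (0, int k mod 2 ^ r)"
  by (induction k; simp add: nat_pow_def Q_model_def mod_simps add.commute)+

lemma Q_model_relations:
  assumes "2 \<le> r" "2 * r \<le> n"
  shows "Q_relations (Q_model n r) (1, 0) (0, 1) n r"
proof -
  interpret group "Q_model n r" using assms(2) by (rule group_Q_model)
  have c: "(1, 0) \<in> carrier (Q_model n r)" "(0, 1) \<in> carrier (Q_model n r)"
    using assms by (auto simp: Q_model_def)
  let ?q = "2 ^ (n - r) :: int"
  have "(1 + ?q - ?q * ((1 + ?q) mod 2 ^ n)) mod 2 ^ n = (1 + ?q - ?q * (1 + ?q)) mod 2 ^ n"
    by (rule mod_diff_cong) (simp_all only: mod_simps)
  also have "\<dots> = 1 mod 2 ^ n"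
    unfolding mod_eq_dvd_iff using power_diff_square_dvd[OF assms(2)] by (simp add: algebra_simps)
  finally have "(1 + ?q - ?q * ((1 + ?q) mod 2 ^ n)) mod 2 ^ n = 1 mod 2 ^ n" .
  then have "(1, 0) \<otimes>\<^bsub>Q_model n r\<^esub> (0, 1) =
    (0, 1) \<otimes>\<^bsub>Q_model n r\<^esub> ((1, 0) \<otimes>\<^bsub>Q_model n r\<^esub> (1, 0) [^]\<^bsub>Q_model n r\<^esub> (2 ^ (n - r) :: nat))"
    by (simp add: Q_model_pow Q_model_mult mod_simps)
  then show ?thesis
  proof (intro Q_relations.intro Q_relations_axioms.intro)
    show "group (Q_model n r)" ..
  qed (use assms c in \<open>simp_all add: Q_model_pow\<close>, simp_all add: Q_model_def)
qed

section \<open>Inverses, powers and generators in presented groups\<close>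

lemma inv_word_class:
  "inv\<^bsub>presented_group S\<^esub> (word_class S w) = word_class S (word_inv w)"
proof -
  interpret group "presented_group S" by (rule group_presented_group)
  show ?thesis
    by (rule inv_equality)
      (simp_all only: mult_presented_group one_presented_group word_class_eq_iff word_inv_cancel
        carrier_presented_group rangeI)
qed

lemma word_class_word_pow:
  "word_class S (word_pow w k) = word_class S w [^]\<^bsub>presented_group S\<^esub> k"
proof (induction k)
  case 0
  show ?case by (simp add: word_pow_def one_presented_group)
next
  case (Suc k)
  have "word_pow w (Suc k) = word_pow w k @ w"
    by (simp add: word_pow_def flip: replicate_append_same)
  then show ?case by (simp add: Suc flip: mult_presented_group)
qed

lemma (in group) word_eval_word_pow:
  assumes "\<And>x. f x \<in> carrier G"
  shows "word_eval G f (word_pow w k) = word_eval G f w [^] k"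
proof (induction k)
  case (Suc k)
  have "word_pow w (Suc k) = word_pow w k @ w"
    by (simp add: word_pow_def flip: replicate_append_same)
  then show ?case by (simp add: Suc word_eval_append[OF assms])
qed (simp add: word_pow_def word_eval_def)

lemma presented_group_generated:
  "carrier (presented_group S) \<subseteq> generate (presented_group S) (range (\<lambda>x. word_class S [(x, True)]))"
proof -
  have "word_class S w \<in> generate (presented_group S) (range (\<lambda>x. word_class S [(x, True)]))" for w
  proof (induction w)
    case Nil
    show ?case using generate.one[of "presented_group S"] by (simp add: one_presented_group)
  next
    case (Cons l w)
    obtain x s where l: "l = (x, s)" by (cases l)
    have "word_class S [(x, False)] = inv\<^bsub>presented_group S\<^esub> (word_class S [(x, True)])"
      by (simp add: inv_word_class word_inv_def)
    then have "word_class S [l] \<in> generate (presented_group S) (range (\<lambda>x. word_class S [(x, True)]))"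
      by (cases s) (auto simp: l intro: generate.incl generate.inv)
    then show ?case
      using generate.eng[OF _ Cons.IH] mult_presented_group[of S "[l]" w] by fastforce
  qed
  then show ?thesis by (auto simp: carrier_presented_group)
qed

section \<open>Uniqueness of the normal form in the presented group\<close>

lemma Q_model_e:
  assumes "2 \<le> r" "2 * r \<le> n"
  shows "Q_relations.e (Q_model n r) (1, 0) (0, 1) i j = (i mod 2 ^ n, int j mod 2 ^ r)"
proof -
  interpret M: Q_relations "Q_model n r" "(1, 0)" "(0, 1)" n r
    by (rule Q_model_relations[OF assms])
  \<comment> \<open>Reducing the exponents makes the one of \<open>a\<close> a natural number, so
    that \<open>Q_model_pow\<close> applies.\<close>
  have "M.e i j = M.e (int (nat (i mod 2 ^ n))) (nat (int j mod 2 ^ r))"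
    using M.e_mod[of i j] by (simp add: M.N_def M.R_def)
  also have "\<dots> = (i mod 2 ^ n, int j mod 2 ^ r)"
    unfolding M.e_def int_pow_int Q_model_pow Q_model_mult by simp
  finally show ?thesis .
qed

text \<open>The model satisfies the defining relations, so von Dyck's theorem maps the presented
  group to it. The image of a normal form displays both exponents as residues, hence equal normal
  forms have congruent exponents.\<close>

lemma Q_group_faithful:
  assumes "2 \<le> r" "2 * r \<le> n"
  shows "\<exists>a b. Q_faithful (Q_group n r) a b n r"
proof -
  define S where "S = {(word_pow [(Gen_a, True)] (2 ^ n), []), (word_pow [(Gen_b, True)] (2 ^ r), []),
    (word_pow [(Gen_a, True)] (2 ^ (n - r)), word_comm [(Gen_a, True)] [(Gen_b, True)])}"
  define a where "a = word_class S [(Gen_a, True)]"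
  define b where "b = word_class S [(Gen_b, True)]"
  interpret group "presented_group S" by (rule group_presented_group)
  have ab: "a \<in> carrier (presented_group S)" "b \<in> carrier (presented_group S)"
    by (simp_all add: a_def b_def carrier_presented_group)
  have rel: "word_class S u = word_class S v" if "(u, v) \<in> S" for u v
    using that by (simp add: word_class_eq_iff word_cong.relation)
  interpret Q: Q_relations "presented_group S" a b n r
  proof (intro Q_relations.intro Q_relations_axioms.intro)
    show "group (presented_group S)" ..
    show "a [^]\<^bsub>presented_group S\<^esub> (2 ^ n :: nat) = \<one>\<^bsub>presented_group S\<^esub>"
      unfolding a_def word_class_word_pow[symmetric] one_presented_group
      by (rule rel) (simp add: S_def)
    show "b [^]\<^bsub>presented_group S\<^esub> (2 ^ r :: nat) = \<one>\<^bsub>presented_group S\<^esub>"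
      unfolding b_def word_class_word_pow[symmetric] one_presented_group
      by (rule rel) (simp add: S_def)
    have "a [^]\<^bsub>presented_group S\<^esub> (2 ^ (n - r) :: nat) =
      word_class S (word_comm [(Gen_a, True)] [(Gen_b, True)])"
      unfolding a_def word_class_word_pow[symmetric] by (rule rel) (simp add: S_def)
    also have "\<dots> = inv\<^bsub>presented_group S\<^esub> a \<otimes>\<^bsub>presented_group S\<^esub> (inv\<^bsub>presented_group S\<^esub> b
      \<otimes>\<^bsub>presented_group S\<^esub> (a \<otimes>\<^bsub>presented_group S\<^esub> b))"
      by (simp only: a_def b_def inv_word_class mult_presented_group word_comm_def append_assoc)
    finally show "a \<otimes>\<^bsub>presented_group S\<^esub> b = b \<otimes>\<^bsub>presented_group S\<^esub>
      (a \<otimes>\<^bsub>presented_group S\<^esub> a [^]\<^bsub>presented_group S\<^esub> (2 ^ (n - r) :: nat))"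
      using ab by (simp flip: m_assoc)
  qed (fact ab assms)+
  interpret M: Q_relations "Q_model n r" "(1, 0)" "(0, 1)" n r
    by (rule Q_model_relations[OF assms])
  define f :: "gen \<Rightarrow> int \<times> int" where "f = case_gen (1, 0) (0, 1)"
  have fc: "f x \<in> carrier (Q_model n r)" for x
    using M.a M.b by (cases x) (simp_all add: f_def)
  have f1: "word_eval (Q_model n r) f [(x, True)] = f x" for x
    using fc by (simp add: word_eval_def)
  have "word_eval (Q_model n r) f (word_comm [(Gen_a, True)] [(Gen_b, True)]) =
    inv\<^bsub>Q_model n r\<^esub> (1, 0) \<otimes>\<^bsub>Q_model n r\<^esub> (inv\<^bsub>Q_model n r\<^esub> (0, 1)
      \<otimes>\<^bsub>Q_model n r\<^esub> ((1, 0) \<otimes>\<^bsub>Q_model n r\<^esub> (0, 1)))"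
    using M.a M.b by (simp add: word_eval_def word_comm_def word_inv_def f_def)
  also have "\<dots> = (1, 0) [^]\<^bsub>Q_model n r\<^esub> (2 ^ (n - r) :: nat)"
    unfolding M.comm using M.a M.b by (simp add: M.inv_solve_left')
  finally have feq: "word_eval (Q_model n r) f u = word_eval (Q_model n r) f v" if "(u, v) \<in> S" for u v
    using that M.a_pow M.b_pow
    by (auto simp: S_def M.word_eval_word_pow[OF fc] f1) (simp_all add: f_def word_eval_def)
  have "\<exists>h\<in>hom (presented_group S) (Q_model n r). \<forall>x. h (word_class S [(x, True)]) = f x"
    by (rule M.presented_group_universal[OF fc feq])
  then obtain h where h: "h \<in> hom (presented_group S) (Q_model n r)"
    and hf: "\<And>x. h (word_class S [(x, True)]) = f x"
    by blast
  interpret h: group_hom "presented_group S" "Q_model n r" h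
    using h by unfold_locales
  have he: "h (Q.e i j) = (i mod 2 ^ n, int j mod 2 ^ r)" for i j
  proof -
    have "h a = (1, 0)" "h b = (0, 1)" by (simp_all add: a_def b_def hf f_def)
    then have "h (Q.e i j) = M.e i j"
      using ab by (simp add: Q.e_def M.e_def h.hom_int_pow h.hom_nat_pow)
    then show ?thesis by (simp add: Q_model_e[OF assms])
  qed
  have "Q_faithful (presented_group S) a b n r"
  proof (intro Q_faithful.intro Q_faithful_axioms.intro Q.Q_relations_axioms)
    have "range (\<lambda>x. word_class S [(x, True)]) \<subseteq> {a, b}"
    proof
      fix y assume "y \<in> range (\<lambda>x. word_class S [(x, True)])"
      then obtain x where "y = word_class S [(x, True)]" by blast
      then show "y \<in> {a, b}" by (cases x) (simp_all add: a_def b_def)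
    qed
    then show "carrier (presented_group S) \<subseteq> generate (presented_group S) {a, b}"
      by (intro subset_trans[OF presented_group_generated] mono_generate)
  next
    fix i j k l assume "Q.e i j = Q.e k l"
    then have "h (Q.e i j) = h (Q.e k l)" by (rule arg_cong)
    then show "Q.N dvd i - k \<and> Q.R dvd int j - int l"
      unfolding he by (simp add: mod_eq_dvd_iff Q.N_def Q.R_def)
  qed
  then show ?thesis
    by (auto simp: Q_group_def S_def Let_def)
qed

theorem mainTheorem2:
  fixes n r :: nat and \<phi> :: "gen word set \<Rightarrow> gen word set"
  assumes "n > 0" and "r > 0" and "2 < 2 * r" and "2 * r \<le> n"
    and "\<phi> \<in> carrier (AutoGroup (Q_group n r))"
    and "group.ord (AutoGroup (Q_group n r)) \<phi> = 2"
    and "\<And>x. x \<in> frattini (Q_group n r) \<Longrightarrow> \<phi> x = x"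
  shows "\<phi> \<in> inner_auto (Q_group n r)"
proof -
  obtain a b where "Q_faithful (Q_group n r) a b n r"
    using Q_group_faithful assms(3,4) by fastforce
  then interpret Q_faithful "Q_group n r" a b n r .
  interpret Aut: group "AutoGroup (Q_group n r)" by (rule AutoGroup)
  have hom: "\<phi> \<in> hom (Q_group n r) (Q_group n r)" and bij: "\<phi> \<in> Bij (carrier (Q_group n r))"
    using assms(5) by (simp_all add: AutoGroup_def auto_def)
  have "\<phi> [^]\<^bsub>AutoGroup (Q_group n r)\<^esub> (2::nat) = \<one>\<^bsub>AutoGroup (Q_group n r)\<^esub>"
    using Aut.pow_ord_eq_1[OF assms(5)] assms(6) by simp
  then have "\<phi> \<otimes>\<^bsub>AutoGroup (Q_group n r)\<^esub> \<phi> = \<one>\<^bsub>AutoGroup (Q_group n r)\<^esub>"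
    using assms(5) by (simp add: numeral_2_eq_2)
  \<comment> \<open>Multiplication in \<open>AutoGroup\<close> is composition restricted to the
    carrier, so order 2 becomes a pointwise identity, evaluated next at \<open>a\<close>.\<close>
  then have "compose (carrier (Q_group n r)) \<phi> \<phi> = (\<lambda>x\<in>carrier (Q_group n r). x)"
    using bij by (simp add: AutoGroup_def BijGroup_def)
  then have "\<phi> (\<phi> a) = a"
    using a by (metis compose_eq restrict_apply')
  then show ?thesis
    using involution_inner hom bij assms(7) by (simp add: Bij_def)
qed

end
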